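(* Let $D=(G,\mathcal{O},w)$ be a weighted oriented graph such that $G$ has no $3$-cycles and no $5$-cycles. Then $I(D)$ is unmixed if and only if: (a) $G$ is well-covered; and (b) for every $(y,x)\in E(D)$ with $y\in V^{+}$, there is $y'\in N_D(x)\setminus\{y\}$ with $N_D(y')\subseteq N_D^{+}(y)$.
   Context: A weighted oriented graph is a triple $D=(G,\mathcal{O},w)$ with $G$ a finite simple graph with vertex set $\{x_1,\dots,x_n\}$, $\mathcal{O}$ an orientation of its edges, $w:V(G)\to\mathbb{N}$; $E(D)$ is the set of oriented edges. $V^{+}=\{x\mid w(x)>1\}$. $I(D)=(x_ix_j^{w(x_j)}\mid (x_i,x_j)\in E(D))\subseteq K[x_1,\dots,x_n]$, $K$ a field; unmixed means all associated primes have the same height. $N_D^{+}(x)=\{y\mid(x,y)\in E(D)\}$, $N_D^{-}(x)=\{y\mid(y,x)\in E(D)\}$, $N_D(x)=N_D^+(x)\cup N_D^-(x)$. A source is a vertex with $N_D^-(x)=\emptyset$; standing convention: every source has weight $1$. $G$ is well-covered if all maximal stable sets of $G$ have the same cardinality. *)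

theory Defs
  imports
    "HOL-Algebra.Ideal"
    "HOL-Decision_Procs.Algebra_Aux"
    "HOL-Library.Poly_Mapping"
    "HOL-Library.Extended_Nat"
begin

section \<open>Associated primes, height, unmixedness\<close>

text \<open>The prime ideals of the form \<open>(I : f)\<close>, i.e. the annihilators in \<open>R\<close> of the
  elements \<open>f + I\<close> of \<open>R/I\<close> that are prime.\<close>

definition associated_primes :: "('a, 'b) ring_scheme \<Rightarrow> 'a set \<Rightarrow> 'a set set" where
  "associated_primes R I =
    {P. primeideal P R \<and>
        (\<exists>f \<in> carrier R. P = {g \<in> carrier R. g \<otimes>\<^bsub>R\<^esub> f \<in> I})}"

text \<open>Supremum of the lengths \<open>n\<close> of chains \<open>C 0 \<subset> C 1 \<subset> \<dots> \<subset> C n = P\<close> of prime ideals.\<close>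

definition ideal_height :: "('a, 'b) ring_scheme \<Rightarrow> 'a set \<Rightarrow> enat" where
  "ideal_height R P =
    Sup {enat n | n. \<exists>C :: nat \<Rightarrow> 'a set.
      (\<forall>i\<le>n. primeideal (C i) R) \<and> (\<forall>i<n. C i \<subset> C (Suc i)) \<and> C n = P}"

definition unmixed :: "('a, 'b) ring_scheme \<Rightarrow> 'a set \<Rightarrow> bool" where
  "unmixed R I \<longleftrightarrow>
    (\<forall>P \<in> associated_primes R I. \<forall>Q \<in> associated_primes R I.
      ideal_height R P = ideal_height R Q)"


section \<open>Simple graphs, given by their sets of edges\<close>

definition has_cycle :: "'v set set \<Rightarrow> nat \<Rightarrow> bool" where
  "has_cycle G k \<longleftrightarrow>
    (\<exists>vs. length vs = k \<and> distinct vs \<and> (\<forall>i<k. {vs ! i, vs ! (Suc i mod k)} \<in> G))"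

definition stable_set :: "'v set set \<Rightarrow> 'v set \<Rightarrow> bool" where
  "stable_set G S \<longleftrightarrow> (\<forall>x \<in> S. \<forall>y \<in> S. {x, y} \<notin> G)"

definition maximal_stable_set :: "'v set set \<Rightarrow> 'v set \<Rightarrow> bool" where
  "maximal_stable_set G S \<longleftrightarrow>
    stable_set G S \<and> (\<forall>T. stable_set G T \<and> S \<subseteq> T \<longrightarrow> T = S)"

definition well_covered :: "'v set set \<Rightarrow> bool" where
  "well_covered G \<longleftrightarrow>
    (\<forall>S T. maximal_stable_set G S \<and> maximal_stable_set G T \<longrightarrow> card S = card T)"


section \<open>Weighted oriented graphs\<close>

definition out_nbrs :: "('v \<times> 'v) set \<Rightarrow> 'v \<Rightarrow> 'v set" where
  "out_nbrs E x = {y. (x, y) \<in> E}"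

definition in_nbrs :: "('v \<times> 'v) set \<Rightarrow> 'v \<Rightarrow> 'v set" where
  "in_nbrs E x = {y. (y, x) \<in> E}"

definition nbrs :: "('v \<times> 'v) set \<Rightarrow> 'v \<Rightarrow> 'v set" where
  "nbrs E x = out_nbrs E x \<union> in_nbrs E x"

definition vplus :: "('v \<Rightarrow> nat) \<Rightarrow> 'v set" where
  "vplus w = {x. 1 < w x}"

text \<open>The vertex set is the finite type \<open>'v\<close>, \<open>G\<close> the set of edges and \<open>E\<close> the set of oriented
  edges. The bijection says that \<open>E\<close> contains exactly one of the two orientations of every edge
  of \<open>G\<close>, and nothing else. Weights are positive: with weight \<open>0\<close> allowed, the ideal would not
  determine the graph.\<close>

locale weighted_oriented_graph =
  fixes G :: "'v::finite set set" and E :: "('v \<times> 'v) set" and w :: "'v \<Rightarrow> nat"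
  assumes simple_graph: "\<And>e. e \<in> G \<Longrightarrow> card e = 2"
    and orientation: "bij_betw (\<lambda>(x, y). {x, y}) E G"
    and weight_pos: "\<And>x. 1 \<le> w x"
    and source_weight: "\<And>x. in_nbrs E x = {} \<Longrightarrow> w x = 1"


section \<open>The edge ideal\<close>

text \<open>Polynomials over \<open>'k\<close> in variables indexed by \<open>'v\<close>: finitely supported maps from exponent
  vectors to coefficients, with the convolution product of the library.\<close>

type_synonym ('v, 'k) mpolynomial = "('v \<Rightarrow>\<^sub>0 nat) \<Rightarrow>\<^sub>0 'k"

definition X :: "'v \<Rightarrow> ('v, 'k::field) mpolynomial" where
  "X x = Poly_Mapping.single (Poly_Mapping.single x 1) 1"

definition edge_ideal ::
    "('v \<times> 'v) set \<Rightarrow> ('v \<Rightarrow> nat) \<Rightarrow> ('v, 'k::field) mpolynomial set" where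
  "edge_ideal E w = Idl\<^bsub>cring_class_ops\<^esub> {X x * X y ^ w y | x y. (x, y) \<in> E}"

end

theory Submission
  imports Defs "HOL-Library.Cardinality"
begin

text \<open>The associated primes of \<open>I(D)\<close> are the ideals generated by the strong vertex covers, and such
  an ideal has height equal to the number of its variables, so \<open>I(D)\<close> is unmixed iff all strong
  covers have the same cardinality. Complements of maximal stable sets are strong covers. Under (b)
  there are no others: a vertex \<open>x\<close> of a strong cover whose neighbours all lie in the cover has a
  heavy in-neighbour \<open>y\<close>; the vertex \<open>y'\<close> given by (b) again has all neighbours in the cover, and
  applying (b) to its heavy in-neighbour \<open>z\<close> produces both \<open>(y, z)\<close> and \<open>(z, y)\<close>. Conversely, if (b)
  fails, the absence of 3- and 5-cycles allows the construction of a strong cover that is not a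
  minimal cover.\<close>

abbreviation lookup where "lookup \<equiv> Poly_Mapping.lookup"
abbreviation keys where "keys \<equiv> Poly_Mapping.keys"
abbreviation single where "single \<equiv> Poly_Mapping.single"

section \<open>Products of polynomials\<close>

lemma sum_single_lookup:
  fixes p :: "'a \<Rightarrow>\<^sub>0 'b::comm_monoid_add"
  shows "(\<Sum>m\<in>keys p. single m (lookup p m)) = p"
proof (rule poly_mapping_eqI)
  fix k
  have "lookup (\<Sum>m\<in>keys p. single m (lookup p m)) k
      = (\<Sum>m\<in>keys p. if m = k then lookup p m else 0)"
    by (simp add: lookup_sum lookup_single when_def)
  then show "lookup (\<Sum>m\<in>keys p. single m (lookup p m)) k = lookup p k"
    by (simp add: in_keys_iff)
qed

text \<open>Only the pair \<open>(a, b)\<close> contributes to this coefficient, so nothing can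
  cancel. Over a field the term therefore survives in the product.\<close>

lemma lookup_mult_unique:
  fixes f g :: "'a::comm_monoid_add \<Rightarrow>\<^sub>0 'b::comm_semiring_0"
  assumes "a \<in> keys f" "b \<in> keys g"
    and uniq: "\<And>a' b'. a' \<in> keys f \<Longrightarrow> b' \<in> keys g \<Longrightarrow> a' + b' = a + b \<Longrightarrow> a' = a \<and> b' = b"
  shows "lookup (f * g) (a + b) = lookup f a * lookup g b"
proof -
  have "lookup (f * g) (a + b)
      = lookup ((\<Sum>m\<in>keys f. single m (lookup f m)) * (\<Sum>n\<in>keys g. single n (lookup g n))) (a + b)"
    by (simp add: sum_single_lookup)
  also have "\<dots> = (\<Sum>m\<in>keys f. \<Sum>n\<in>keys g. if m + n = a + b then lookup f m * lookup g n else 0)"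
    by (simp add: sum_product mult_single lookup_sum lookup_single when_def)
  also have "\<dots> = (\<Sum>m\<in>keys f. \<Sum>n\<in>keys g. if m = a then if n = b then lookup f m * lookup g n else 0 else 0)"
    by (intro sum.cong refl) (use uniq in auto)
  also have "\<dots> = (\<Sum>m\<in>keys f. if m = a then lookup f a * lookup g b else 0)"
    using assms(2) by (intro sum.cong refl) auto
  also have "\<dots> = lookup f a * lookup g b"
    using assms(1) by simp
  finally show ?thesis .
qed

text \<open>Adding \<open>t\<close> is cancellative, so shifted terms never merge, and
  multiplication by \<open>c \<noteq> 0\<close> kills none of them.\<close>

lemma keys_mult_single:
  fixes f :: "'a::cancel_comm_monoid_add \<Rightarrow>\<^sub>0 'b::field"
  assumes "c \<noteq> 0"
  shows "keys (f * single t c) = (\<lambda>u. u + t) ` keys f"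
proof
  show "keys (f * single t c) \<subseteq> (\<lambda>u. u + t) ` keys f"
    using keys_mult[of f "single t c"] assms by auto
  have "lookup (f * single t c) (u + t) \<noteq> 0" if "u \<in> keys f" for u
  proof -
    have "lookup (f * single t c) (u + t) = lookup f u * lookup (single t c) t"
      by (rule lookup_mult_unique) (use that assms in \<open>auto split: if_splits\<close>)
    then show ?thesis
      using that assms by (simp add: in_keys_iff)
  qed
  then show "(\<lambda>u. u + t) ` keys f \<subseteq> keys (f * single t c)"
    by (auto simp: in_keys_iff)
qed

text \<open>The variables carry no order, so exponent vectors are compared through an additive embedding
  into the linearly ordered monoid of finitely supported sequences; the sum of the two maxima has
  only one decomposition.\<close>

lemma exists_unique_sum:
  fixes A B :: "('v::finite \<Rightarrow>\<^sub>0 nat) set"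
  assumes "finite A" "A \<noteq> {}" "finite B" "B \<noteq> {}"
  obtains a b where "a \<in> A" "b \<in> B"
    "\<And>a' b'. a' \<in> A \<Longrightarrow> b' \<in> B \<Longrightarrow> a' + b' = a + b \<Longrightarrow> a' = a \<and> b' = b"
proof -
  obtain idx :: "'v \<Rightarrow> nat" where idx: "inj idx"
    using finite_imp_inj_to_nat_seg[OF finite] by blast
  define h :: "('v \<Rightarrow>\<^sub>0 nat) \<Rightarrow> (nat \<Rightarrow>\<^sub>0 nat)" where
    "h m = (\<Sum>x\<in>UNIV. single (idx x) (lookup m x))" for m
  have h_add: "h (m + n) = h m + h n" for m n
    by (simp add: h_def lookup_add single_add sum.distrib)
  have "lookup (h m) (idx x) = lookup m x" for m x
    using idx by (simp add: h_def lookup_sum lookup_single when_def inj_eq)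
  then have h_inj: "m = n" if "h m = h n" for m n
    using that by (metis poly_mapping_eqI)
  obtain a where a: "a \<in> A" "\<And>a'. a' \<in> A \<Longrightarrow> h a' \<le> h a"
    using Max_in[of "h ` A"] Max_ge[of "h ` A"] assms(1,2) by fastforce
  obtain b where b: "b \<in> B" "\<And>b'. b' \<in> B \<Longrightarrow> h b' \<le> h b"
    using Max_in[of "h ` B"] Max_ge[of "h ` B"] assms(3,4) by fastforce
  show thesis
  proof (rule that[OF a(1) b(1)])
    fix a' b' assume *: "a' \<in> A" "b' \<in> B" "a' + b' = a + b"
    then have sum: "h a' + h b' = h a + h b"
      by (metis h_add)
    have "h a' = h a"
    proof (rule ccontr)
      assume "h a' \<noteq> h a"
      then have "h a' < h a"
        using a(2)[OF *(1)] by simp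
      then have "h a' + h b' < h a + h b"
        using b(2)[OF *(2)] by (rule add_less_le_mono)
      then show False
        using sum by simp
    qed
    then show "a' = a \<and> b' = b"
      using sum h_inj by auto
  qed
qed


section \<open>Monomial ideals\<close>

lemma ideal_class_iff:
  fixes P :: "'a::comm_ring_1 set"
  shows "ideal P cring_class_ops \<longleftrightarrow>
    0 \<in> P \<and> (\<forall>a\<in>P. \<forall>b\<in>P. a + b \<in> P) \<and> (\<forall>a\<in>P. \<forall>r. r * a \<in> P)"
proof
  assume "ideal P cring_class_ops"
  then interpret ideal P cring_class_ops .
  show "0 \<in> P \<and> (\<forall>a\<in>P. \<forall>b\<in>P. a + b \<in> P) \<and> (\<forall>a\<in>P. \<forall>r. r * a \<in> P)"
    using zero_closed a_closed I_l_closed by (simp add: class_simps)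
next
  assume *: "0 \<in> P \<and> (\<forall>a\<in>P. \<forall>b\<in>P. a + b \<in> P) \<and> (\<forall>a\<in>P. \<forall>r. r * a \<in> P)"
  then have neg: "- a \<in> P" if "a \<in> P" for a
    using that by (metis mult_minus1)
  show "ideal P cring_class_ops"
  proof (rule idealI)
    show "ring (cring_class_ops :: 'a ring)"
      by (rule cring_class.ring_axioms)
    show "subgroup P (add_monoid cring_class_ops)"
    proof (rule subgroup.intro)
      show "inv\<^bsub>add_monoid cring_class_ops\<^esub> a \<in> P" if "a \<in> P" for a
        using neg[OF that] uminus_class[of a] by (simp add: a_inv_def)
    qed (use * in \<open>auto simp: class_simps\<close>)
  qed (use * in \<open>auto simp: class_simps mult.commute\<close>)
qed

lemma primeideal_class_iff:
  fixes P :: "'a::comm_ring_1 set"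
  shows "primeideal P cring_class_ops \<longleftrightarrow>
    ideal P cring_class_ops \<and> P \<noteq> UNIV \<and> (\<forall>a b. a * b \<in> P \<longrightarrow> a \<in> P \<or> b \<in> P)"
proof
  assume "primeideal P cring_class_ops"
  then interpret primeideal P cring_class_ops .
  show "ideal P cring_class_ops \<and> P \<noteq> UNIV \<and> (\<forall>a b. a * b \<in> P \<longrightarrow> a \<in> P \<or> b \<in> P)"
    using ideal_axioms I_notcarr I_prime by (auto simp: class_simps cring_class_ops_def)
next
  assume "ideal P cring_class_ops \<and> P \<noteq> UNIV \<and> (\<forall>a b. a * b \<in> P \<longrightarrow> a \<in> P \<or> b \<in> P)"
  then show "primeideal P cring_class_ops"
    by (intro primeidealI cring_class) (auto simp: class_simps UNIV_eq_I)
qed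

lemma ideal_class_sum:
  assumes "ideal P (cring_class_ops :: 'a::comm_ring_1 ring)" "\<And>i. i \<in> I \<Longrightarrow> f i \<in> P"
  shows "sum f I \<in> P"
  using assms(2) by (induction I rule: infinite_finite_induct) (use assms(1) in \<open>auto simp: ideal_class_iff\<close>)

lemma ideal_class_diff:
  assumes "ideal P (cring_class_ops :: 'a::comm_ring_1 ring)" "a \<in> P" "b \<in> P"
  shows "a - b \<in> P"
  using assms unfolding ideal_class_iff by (metis mult_minus1 add_uminus_conv_diff)

lemma ideal_class_eq_UNIV_iff:
  assumes "ideal P (cring_class_ops :: 'a::comm_ring_1 ring)"
  shows "P = UNIV \<longleftrightarrow> 1 \<in> P"
  using assms unfolding ideal_class_iff by (metis UNIV_eq_I UNIV_I mult.right_neutral)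

text \<open>Encoding the ideal by the exponents it admits makes membership a test on each term
  separately. It is an ideal when \<open>M\<close> is closed under adding exponents.\<close>

definition monomial_ideal :: "('v \<Rightarrow>\<^sub>0 nat) set \<Rightarrow> ('v, 'k::field) mpolynomial set" where
  "monomial_ideal M = {p. keys p \<subseteq> M}"

definition up_closed :: "('v \<Rightarrow>\<^sub>0 nat) set \<Rightarrow> bool" where
  "up_closed M \<longleftrightarrow> (\<forall>m\<in>M. \<forall>u. u + m \<in> M)"

lemma ideal_monomial_ideal:
  assumes "up_closed M"
  shows "ideal (monomial_ideal M :: ('v, 'k::field) mpolynomial set) cring_class_ops"
  unfolding ideal_class_iff
proof (intro conjI ballI allI)
  fix a b :: "('v, 'k) mpolynomial"
  assume a: "a \<in> monomial_ideal M"
  show "a + b \<in> monomial_ideal M" if "b \<in> monomial_ideal M"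
    using a that keys_add[of a b] by (auto simp: monomial_ideal_def)
  show "b * a \<in> monomial_ideal M"
    using a assms keys_mult[of b a] by (fastforce simp: monomial_ideal_def up_closed_def)
qed (simp add: monomial_ideal_def)

lemma single_in_monomial_ideal:
  "single m (1::'k::field) \<in> monomial_ideal M \<longleftrightarrow> m \<in> M"
  by (simp add: monomial_ideal_def)

text \<open>These are the exponents of monomials divisible by a variable from \<open>C\<close>, so
  \<open>var_ideal C\<close> is the ideal generated by those variables.\<close>

definition var_monomials :: "'v set \<Rightarrow> ('v \<Rightarrow>\<^sub>0 nat) set" where
  "var_monomials C = {m. keys m \<inter> C \<noteq> {}}"

abbreviation var_ideal :: "'v set \<Rightarrow> ('v, 'k::field) mpolynomial set" where
  "var_ideal C \<equiv> monomial_ideal (var_monomials C)"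

lemma keys_exponent_add: "keys (m + n :: 'v \<Rightarrow>\<^sub>0 nat) = keys m \<union> keys n"
  by (auto simp: in_keys_iff lookup_add)

lemma add_in_var_monomials:
  "m + n \<in> var_monomials C \<longleftrightarrow> m \<in> var_monomials C \<or> n \<in> var_monomials C"
  by (auto simp: var_monomials_def keys_exponent_add)

lemma single_in_var_monomials: "single x (Suc 0) \<in> var_monomials C \<longleftrightarrow> x \<in> C"
  by (auto simp: var_monomials_def)

lemma up_closed_var_monomials: "up_closed (var_monomials C)"
  by (simp add: up_closed_def add_in_var_monomials)

text \<open>If neither factor is in the ideal, both have terms free of \<open>C\<close>. Among these
  some pair has a sum with no other decomposition, and its product is a term of \<open>p * q\<close>
  free of \<open>C\<close>.\<close>

lemma primeideal_var_ideal:
  "primeideal (var_ideal C :: ('v::finite, 'k::field) mpolynomial set) cring_class_ops"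
  unfolding primeideal_class_iff
proof (intro conjI allI impI)
  show id: "ideal (var_ideal C :: ('v, 'k) mpolynomial set) cring_class_ops"
    by (rule ideal_monomial_ideal[OF up_closed_var_monomials])
  have "(1 :: ('v, 'k) mpolynomial) \<notin> var_ideal C"
    by (simp add: monomial_ideal_def var_monomials_def)
  then show "(var_ideal C :: ('v, 'k) mpolynomial set) \<noteq> UNIV"
    by auto
  fix p q :: "('v, 'k) mpolynomial"
  assume pq: "p * q \<in> var_ideal C"
  show "p \<in> var_ideal C \<or> q \<in> var_ideal C"
  proof (rule ccontr)
    assume *: "\<not> (p \<in> var_ideal C \<or> q \<in> var_ideal C)"
    then have "keys p - var_monomials C \<noteq> {}" "keys q - var_monomials C \<noteq> {}"
      by (auto simp: monomial_ideal_def)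
    then obtain a b where ab: "a \<in> keys p - var_monomials C" "b \<in> keys q - var_monomials C"
      and uniq: "\<And>a' b'. a' \<in> keys p - var_monomials C \<Longrightarrow> b' \<in> keys q - var_monomials C \<Longrightarrow>
        a' + b' = a + b \<Longrightarrow> a' = a \<and> b' = b"
      using exists_unique_sum[of "keys p - var_monomials C" "keys q - var_monomials C"]
      by (metis finite_Diff finite_keys)
    have nin: "a + b \<notin> var_monomials C"
      using ab by (simp add: add_in_var_monomials)
    have "lookup (p * q) (a + b) = lookup p a * lookup q b"
    proof (rule lookup_mult_unique)
      \<comment> \<open>Since \<open>a + b\<close> is free of \<open>C\<close>, so are
        \<open>a'\<close> and \<open>b'\<close>; uniqueness among the terms free of \<open>C\<close>
        is enough.\<close>
      fix a' b' assume "a' \<in> keys p" "b' \<in> keys q" "a' + b' = a + b"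
      with nin show "a' = a \<and> b' = b"
        by (metis DiffI add_in_var_monomials uniq)
    qed (use ab in auto)
    then have "a + b \<in> keys (p * q)"
      using ab by (simp add: in_keys_iff)
    then show False
      using pq nin by (auto simp: monomial_ideal_def)
  qed
qed

lemma var_ideal_strict_mono:
  assumes "C \<subset> D"
  shows "var_ideal C \<subset> (var_ideal D :: ('v, 'k::field) mpolynomial set)"
proof -
  obtain x where x: "x \<in> D" "x \<notin> C"
    using assms by auto
  have "(single (single x (Suc 0)) 1 :: ('v, 'k) mpolynomial) \<in> var_ideal D - var_ideal C"
    using x by (simp add: single_in_monomial_ideal single_in_var_monomials)
  moreover have "var_ideal C \<subseteq> (var_ideal D :: ('v, 'k) mpolynomial set)"
    using assms by (auto simp: monomial_ideal_def var_monomials_def)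
  ultimately show ?thesis
    by blast
qed


section \<open>Heights\<close>

text \<open>Exponents form a list because removing its head removes \<open>f 0\<close> and shifts
  the family, just as dropping the first prime shifts a chain.\<close>

fun power_product :: "(nat \<Rightarrow> 'a::comm_monoid_mult) \<Rightarrow> nat list \<Rightarrow> 'a" where
  "power_product f [] = 1"
| "power_product f (j # js) = f 0 ^ j * power_product (\<lambda>i. f (Suc i)) js"

abbreviation exponent_lists :: "nat \<Rightarrow> nat \<Rightarrow> nat list set" where
  "exponent_lists N m \<equiv> {js. set js \<subseteq> {..N} \<and> length js = m}"

text \<open>Factoring out \<open>f ^ j\<close> leaves \<open>h j + f * r\<close>. As
  \<open>P\<close> is prime and \<open>f \<notin> P\<close>, this factor lies in
  \<open>P \<subseteq> Q\<close>, and \<open>f \<in> Q\<close> removes the tail.\<close>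

lemma lowest_coefficient_in_ideal:
  fixes P Q :: "'a::comm_ring_1 set"
  assumes P: "primeideal P cring_class_ops" and Q: "primeideal Q cring_class_ops"
    and "P \<subseteq> Q" "f \<in> Q" "f \<notin> P"
    and sum: "(\<Sum>i\<le>N. f ^ i * h i) \<in> P" and zero: "\<And>i. i < j \<Longrightarrow> h i = 0" and "j \<le> N"
  shows "h j \<in> Q"
proof -
  define r where "r = (\<Sum>i\<in>{Suc j..N}. f ^ (i - Suc j) * h i)"
  have "(\<Sum>i\<le>N. f ^ i * h i) = (\<Sum>i\<in>{j..N}. f ^ i * h i)"
    by (rule sum.mono_neutral_right) (use zero in auto)
  also have "\<dots> = f ^ j * h j + (\<Sum>i\<in>{Suc j..N}. f ^ i * h i)"
    using \<open>j \<le> N\<close> by (rule sum.atLeast_Suc_atMost)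
  also have "(\<Sum>i\<in>{Suc j..N}. f ^ i * h i) = f ^ j * (f * r)"
    unfolding r_def sum_distrib_left
  proof (intro sum.cong refl)
    fix i assume "i \<in> {Suc j..N}"
    then have "f ^ i = f ^ j * (f * f ^ (i - Suc j))"
      by (metis Suc_le_eq atLeastAtMost_iff le_add_diff_inverse less_imp_le_nat power_Suc
          power_add Suc_diff_Suc)
    then show "f ^ i * h i = f ^ j * (f * (f ^ (i - Suc j) * h i))"
      by (simp add: ac_simps)
  qed
  finally have *: "f ^ j * (h j + f * r) \<in> P"
    using sum by (simp add: distrib_left)
  have "f ^ j \<notin> P"
  proof (induction j)
    case 0
    then show ?case
      using P ideal_class_eq_UNIV_iff by (auto simp: primeideal_class_iff)
  qed (use P \<open>f \<notin> P\<close> in \<open>auto simp: primeideal_class_iff\<close>)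
  then have "h j + f * r \<in> Q"
    using * P \<open>P \<subseteq> Q\<close> unfolding primeideal_class_iff by blast
  moreover have "f * r \<in> Q"
    using Q \<open>f \<in> Q\<close> by (metis ideal_class_iff primeideal_class_iff mult.commute)
  ultimately show ?thesis
    using Q ideal_class_diff[of Q "h j + f * r" "f * r"] by (simp add: primeideal_class_iff)
qed

text \<open>Linear independence modulo \<open>P 0\<close> over the constants
  \<open>single 0 c\<close>. A relation is expanded in powers of \<open>f 0\<close>; each
  coefficient, from the lowest upwards, becomes a relation modulo \<open>P 1\<close> for the shifted
  chain.\<close>

lemma power_products_independent:
  fixes P :: "nat \<Rightarrow> ('v, 'k::field) mpolynomial set"
  assumes "\<And>i. i \<le> m \<Longrightarrow> primeideal (P i) cring_class_ops"
    and "\<And>i. i < m \<Longrightarrow> P i \<subseteq> P (Suc i)"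
    and "\<And>i. i < m \<Longrightarrow> f i \<in> P (Suc i) - P i"
    and "(\<Sum>js\<in>exponent_lists N m. single 0 (c js) * power_product f js) \<in> P 0"
    and "js \<in> exponent_lists N m"
  shows "c js = 0"
  using assms
proof (induction m arbitrary: P f c js)
  case 0
  have id: "ideal (P 0) cring_class_ops" and "1 \<notin> P 0"
    using 0(1)[of 0] ideal_class_eq_UNIV_iff by (auto simp: primeideal_class_iff)
  have "exponent_lists N 0 = {[]}"
    by auto
  then have c: "single 0 (c []) \<in> P 0" and js: "js = []"
    using 0 by auto
  \<comment> \<open>A nonzero constant would be a unit in the proper ideal
    \<open>P 0\<close>.\<close>
  show ?case
  proof (rule ccontr)
    assume "c js \<noteq> 0"
    then have "single 0 (inverse (c [])) * single 0 (c []) = (1 :: ('v, 'k) mpolynomial)"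
      using js by (simp add: mult_single)
    then show False
      using id c \<open>1 \<notin> P 0\<close> unfolding ideal_class_iff by metis
  qed
next
  case (Suc m)
  define f' where "f' = (\<lambda>i. f (Suc i))"
  define h where "h j = (\<Sum>js\<in>exponent_lists N m. single 0 (c (j # js)) * power_product f' js)" for j
  have "(\<Sum>js\<in>exponent_lists N (Suc m). single 0 (c js) * power_product f js)
      = (\<Sum>(js, j)\<in>exponent_lists N m \<times> {..N}. single 0 (c (j # js)) * (f 0 ^ j * power_product f' js))"
    unfolding lists_length_Suc_eq
    by (subst sum.reindex) (auto simp: inj_on_def f'_def intro!: sum.cong)
  also have "\<dots> = (\<Sum>js\<in>exponent_lists N m. \<Sum>j\<le>N. single 0 (c (j # js)) * (f 0 ^ j * power_product f' js))"
    by (simp add: sum.cartesian_product)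
  also have "\<dots> = (\<Sum>j\<le>N. f 0 ^ j * h j)"
    by (subst sum.swap) (simp add: h_def sum_distrib_left ac_simps)
  finally have sum: "(\<Sum>j\<le>N. f 0 ^ j * h j) \<in> P 0"
    using Suc.prems(4) by simp
  \<comment> \<open>Once the coefficients below \<open>j\<close> vanish, \<open>h j\<close> lies in
    \<open>P (Suc 0)\<close>, and the outer induction hypothesis applies to it.\<close>
  have *: "c (j # ks) = 0" if "j \<le> N" "ks \<in> exponent_lists N m" for j ks
    using that
  proof (induction j arbitrary: ks rule: less_induct)
    case (less j)
    have "h i = 0" if "i < j" for i
      unfolding h_def using less that by (intro sum.neutral) auto
    then have "h j \<in> P (Suc 0)"
      using lowest_coefficient_in_ideal[of "P 0" "P (Suc 0)" "f 0" h N j] sum less.prems(1)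
        Suc.prems(1)[of 0] Suc.prems(1)[of "Suc 0"] Suc.prems(2)[of 0] Suc.prems(3)[of 0] by auto
    then show ?case
      using Suc.IH[of "\<lambda>i. P (Suc i)" f' "\<lambda>js. c (j # js)" ks] Suc.prems(1-3) less.prems(2)
      unfolding h_def f'_def by auto
  qed
  then show ?case
    using Suc.prems(5) by (cases js) auto
qed

text \<open>Polynomials form a vector space over the constants, and all \<open>g i\<close> lie in
  the span of the monomials with exponent in \<open>T\<close>.\<close>

lemma independent_family_card_le:
  fixes g :: "'i \<Rightarrow> ('v, 'k::field) mpolynomial"
  assumes "finite I" "finite T" and keys: "\<And>i. i \<in> I \<Longrightarrow> keys (g i) \<subseteq> T"
    and indep: "\<And>c i. (\<Sum>i\<in>I. single 0 (c i) * g i) = 0 \<Longrightarrow> i \<in> I \<Longrightarrow> c i = 0"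
  shows "card I \<le> card T"
proof -
  interpret vector_space "\<lambda>c (p :: ('v, 'k) mpolynomial). single 0 c * p"
    by unfold_locales (simp_all add: algebra_simps single_add mult_single flip: mult.assoc)
  \<comment> \<open>A repetition \<open>g i = g j\<close> would be the nontrivial relation with
    coefficients \<open>1\<close> and \<open>- 1\<close>.\<close>
  have inj: "inj_on g I"
  proof (rule inj_onI, rule ccontr)
    fix i j assume ij: "i \<in> I" "j \<in> I" "g i = g j" "i \<noteq> j"
    define c :: "'i \<Rightarrow> 'k" where "c = (\<lambda>k. if k = i then 1 else if k = j then - 1 else 0)"
    have "(\<Sum>k\<in>I. single 0 (c k) * g k) = (\<Sum>k\<in>{i, j}. single 0 (c k) * g k)"
      by (rule sum.mono_neutral_right) (use ij \<open>finite I\<close> in \<open>auto simp: c_def\<close>)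
    also have "\<dots> = 0"
      using ij by (simp add: c_def single_uminus)
    finally have "c i = 0"
      using indep ij(1) by blast
    then show False
      by (simp add: c_def)
  qed
  have "independent (g ` I)"
  proof (rule independent_if_scalars_zero)
    fix c p assume *: "(\<Sum>p\<in>g ` I. single 0 (c p) * p) = 0" "p \<in> g ` I"
    then have "(\<Sum>i\<in>I. single 0 (c (g i)) * g i) = 0"
      by (simp add: sum.reindex[OF inj])
    then show "c p = 0"
      using indep[of "\<lambda>i. c (g i)"] *(2) by auto
  qed (use \<open>finite I\<close> in simp)
  moreover have "g ` I \<subseteq> span ((\<lambda>m. single m 1) ` T)"
  proof (intro image_subsetI)
    fix i assume i: "i \<in> I"
    have "(\<Sum>m\<in>keys (g i). single 0 (lookup (g i) m) * single m 1) \<in> span ((\<lambda>m. single m 1) ` T)"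
      by (intro span_sum span_scale span_base) (use keys[OF i] in auto)
    then show "g i \<in> span ((\<lambda>m. single m 1) ` T)"
      by (simp add: mult_single sum_single_lookup)
  qed
  ultimately have "card (g ` I) \<le> card ((\<lambda>m. single m (1::'k)) ` T)"
    using independent_span_bound \<open>finite T\<close> by blast
  also have "\<dots> \<le> card T"
    by (rule card_image_le[OF \<open>finite T\<close>])
  finally show ?thesis
    by (simp add: card_image[OF inj])
qed

text \<open>Bounding each exponent separately, not the total degree, reduces counting to counting
  functions into \<open>{..d}\<close>.\<close>

definition exponent_box :: "nat \<Rightarrow> ('v \<Rightarrow>\<^sub>0 nat) set" where
  "exponent_box d = {m. \<forall>x. lookup m x \<le> d}"

lemma exponent_box_finite_card:
  "finite (exponent_box d :: ('v::finite \<Rightarrow>\<^sub>0 nat) set)"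
  "card (exponent_box d :: ('v::finite \<Rightarrow>\<^sub>0 nat) set) \<le> Suc d ^ CARD('v)"
proof -
  let ?F = "UNIV \<rightarrow>\<^sub>E {..d} :: ('v \<Rightarrow> nat) set"
  have fin: "finite ?F"
    by (intro finite_PiE) auto
  have inj: "inj_on lookup (exponent_box d :: ('v \<Rightarrow>\<^sub>0 nat) set)"
    by (intro inj_onI poly_mapping_eqI) simp
  have sub: "lookup ` exponent_box d \<subseteq> ?F"
    by (force simp: exponent_box_def PiE_UNIV_domain)
  show "finite (exponent_box d :: ('v \<Rightarrow>\<^sub>0 nat) set)"
    using inj_on_finite[OF inj sub fin] .
  show "card (exponent_box d :: ('v \<Rightarrow>\<^sub>0 nat) set) \<le> Suc d ^ CARD('v)"
    using card_inj_on_le[OF inj sub fin] by (simp add: card_PiE)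
qed

lemma exponent_box_mono: "d \<le> e \<Longrightarrow> exponent_box d \<subseteq> exponent_box e"
  by (auto simp: exponent_box_def intro: order_trans)

lemma keys_mult_in_box:
  fixes p q :: "('v, 'k::field) mpolynomial"
  assumes "keys p \<subseteq> exponent_box d" "keys q \<subseteq> exponent_box e"
  shows "keys (p * q) \<subseteq> exponent_box (d + e)"
proof
  fix m assume "m \<in> keys (p * q)"
  then obtain a b where "a \<in> keys p" "b \<in> keys q" "m = a + b"
    using keys_mult[of p q] by auto
  then show "m \<in> exponent_box (d + e)"
    using assms by (fastforce simp: exponent_box_def lookup_add intro: add_mono)
qed

lemma keys_power_in_box:
  fixes p :: "('v, 'k::field) mpolynomial"
  assumes "keys p \<subseteq> exponent_box d"
  shows "keys (p ^ j) \<subseteq> exponent_box (j * d)"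
proof (induction j)
  case (Suc j)
  then show ?case
    using keys_mult_in_box[OF assms Suc] by simp
qed (simp add: exponent_box_def)

lemma keys_power_product_in_box:
  fixes f :: "nat \<Rightarrow> ('v, 'k::field) mpolynomial"
  assumes "\<And>i. i < length js \<Longrightarrow> keys (f i) \<subseteq> exponent_box d" "set js \<subseteq> {..N}"
  shows "keys (power_product f js) \<subseteq> exponent_box (length js * (N * d))"
  using assms
proof (induction js arbitrary: f)
  case (Cons j js)
  have "keys (f 0 ^ j) \<subseteq> exponent_box (j * d)"
    using Cons.prems(1)[of 0] by (intro keys_power_in_box) auto
  also have "\<dots> \<subseteq> exponent_box (N * d)"
    using Cons.prems(2) by (intro exponent_box_mono) auto
  finally have "keys (f 0 ^ j) \<subseteq> exponent_box (N * d)" .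
  moreover have "keys (power_product (\<lambda>i. f (Suc i)) js) \<subseteq> exponent_box (length js * (N * d))"
    using Cons.prems by (intro Cons.IH) auto
  ultimately show ?case
    using keys_mult_in_box[of "f 0 ^ j" "N * d"] by simp
qed (simp add: exponent_box_def)

lemma keys_subset_box:
  fixes p :: "('v::finite, 'k::field) mpolynomial"
  shows "\<exists>d. keys p \<subseteq> exponent_box d"
proof
  let ?d = "\<Sum>m\<in>keys p. \<Sum>x\<in>UNIV. lookup m x"
  show "keys p \<subseteq> exponent_box ?d"
  proof
    fix m assume m: "m \<in> keys p"
    have "lookup m x \<le> ?d" for x
    proof -
      have "lookup m x \<le> (\<Sum>x\<in>UNIV. lookup m x)"
        by (rule member_le_sum) auto
      also have "\<dots> \<le> ?d"
        using m by (intro member_le_sum) auto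
      finally show ?thesis .
    qed
    then show "m \<in> exponent_box ?d"
      by (simp add: exponent_box_def)
  qed
qed

text \<open>A strict chain of \<open>m\<close> prime inclusions yields \<open>(N + 1) ^ m\<close> independent power products of
  degree linear in \<open>N\<close>, while there are only polynomially many, of order \<open>N ^ CARD('v)\<close>,
  monomials of that degree.\<close>

lemma prime_chain_length_le:
  fixes P :: "nat \<Rightarrow> ('v::finite, 'k::field) mpolynomial set"
  assumes prime: "\<And>i. i \<le> m \<Longrightarrow> primeideal (P i) cring_class_ops"
    and strict: "\<And>i. i < m \<Longrightarrow> P i \<subset> P (Suc i)"
  shows "m \<le> CARD('v)"
proof (rule ccontr)
  assume "\<not> m \<le> CARD('v)"
  then have m: "Suc CARD('v) \<le> m"
    by simp
  have "\<exists>f. f \<in> P (Suc i) - P i" if "i < m" for i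
    using strict[OF that] by auto
  then obtain f where f: "\<And>i. i < m \<Longrightarrow> f i \<in> P (Suc i) - P i"
    by metis
  obtain d where d: "\<And>i. keys (f i) \<subseteq> exponent_box (d i)"
    using choice[of "\<lambda>i d. keys (f i) \<subseteq> exponent_box d"] keys_subset_box by blast
  \<comment> \<open>The sum dominates each \<open>d i\<close> with \<open>i < m\<close>, so one box
    serves for all these \<open>f i\<close>.\<close>
  define D where "D = (\<Sum>i<m. d i)"
  have box: "keys (f i) \<subseteq> exponent_box D" if "i < m" for i
  proof -
    have "d i \<le> D"
      unfolding D_def using that by (intro member_le_sum) auto
    then show ?thesis
      using d[of i] exponent_box_mono by blast
  qed
  \<comment> \<open>With \<open>n = CARD('v)\<close>, the monomial count is at most
    \<open>(m * D + 1) ^ n * (N + 1) ^ n\<close>. This choice turns it into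
    \<open>N * (N + 1) ^ n\<close>, just below \<open>(N + 1) ^ (n + 1)\<close>.\<close>
  define N where "N = Suc (m * D) ^ CARD('v)"
  have "Suc N ^ m = card (exponent_lists N m)"
    by (simp add: card_lists_length_eq)
  also have "\<dots> \<le> card (exponent_box (m * (N * D)) :: ('v \<Rightarrow>\<^sub>0 nat) set)"
  proof (rule independent_family_card_le)
    show "finite (exponent_lists N m)"
      by (simp add: finite_lists_length_eq)
    show "finite (exponent_box (m * (N * D)) :: ('v \<Rightarrow>\<^sub>0 nat) set)"
      by (rule exponent_box_finite_card)
    show "keys (power_product f js) \<subseteq> exponent_box (m * (N * D))" if "js \<in> exponent_lists N m" for js
      using keys_power_product_in_box[of js f D N] box that by auto
    fix c js
    assume "(\<Sum>js\<in>exponent_lists N m. single 0 (c js) * power_product f js) = 0"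
      and "js \<in> exponent_lists N m"
    moreover have "0 \<in> P 0"
      using prime[of 0] by (auto simp: primeideal_class_iff ideal_class_iff)
    ultimately show "c js = 0"
      using power_products_independent[of m P f c N js] prime strict f by auto
  qed
  also have "\<dots> \<le> Suc (m * (N * D)) ^ CARD('v)"
    by (rule exponent_box_finite_card)
  also have "\<dots> \<le> (Suc (m * D) * Suc N) ^ CARD('v)"
    by (intro power_mono) (auto simp: algebra_simps)
  also have "\<dots> = N * Suc N ^ CARD('v)"
    by (simp only: power_mult_distrib N_def)
  also have "\<dots> < Suc N ^ Suc CARD('v)"
    by simp
  also have "\<dots> \<le> Suc N ^ m"
    using m by (intro power_increasing) auto
  finally show False
    by simp
qed

section \<open>Heights of ideals generated by variables\<close>

lemma exists_subset_chain:
  fixes A B :: "'v::finite set"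
  assumes "A \<subseteq> B"
  obtains D where "D 0 = A" "D (card B - card A) = B" "\<And>i. i < card B - card A \<Longrightarrow> D i \<subset> D (Suc i)"
proof -
  obtain xs where xs: "set xs = B - A" "distinct xs"
    using finite_distinct_list[of "B - A"] by auto
  have len: "length xs = card B - card A"
    using assms xs by (metis card_Diff_subset distinct_card finite)
  show thesis
  proof (rule that[of "\<lambda>i. A \<union> set (take i xs)"])
    show "A \<union> set (take (card B - card A) xs) = B"
      using len xs assms by auto
    fix i assume "i < card B - card A"
    then have i: "i < length xs"
      using len by simp
    then have "xs ! i \<notin> set (take i xs)"
      using xs(2) by (auto simp: in_set_conv_nth nth_eq_iff_index_eq)
    moreover have "xs ! i \<notin> A"
      using i xs(1) nth_mem by blast
    ultimately show "A \<union> set (take i xs) \<subset> A \<union> set (take (Suc i) xs)"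
      using i by (auto simp: take_Suc_conv_app_nth)
  qed auto
qed

text \<open>Adding the variables of \<open>C\<close> one at a time gives a chain of length
  \<open>card C\<close>. Conversely, any chain ending at \<open>var_ideal C\<close> can be prolonged
  by the remaining variables, and the total length is at most \<open>CARD('v)\<close>.\<close>

lemma ideal_height_var_ideal:
  "ideal_height cring_class_ops (var_ideal C :: ('v::finite, 'k::field) mpolynomial set) = enat (card C)"
proof -
  let ?S = "{enat n | n. \<exists>Q :: nat \<Rightarrow> ('v, 'k) mpolynomial set.
      (\<forall>i\<le>n. primeideal (Q i) cring_class_ops) \<and> (\<forall>i<n. Q i \<subset> Q (Suc i)) \<and> Q n = var_ideal C}"
  have "n \<le> card C" if Q: "\<And>i. i \<le> n \<Longrightarrow> primeideal (Q i) cring_class_ops"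
    "\<And>i. i < n \<Longrightarrow> Q i \<subset> Q (Suc i)" "Q n = var_ideal C"
    for n and Q :: "nat \<Rightarrow> ('v, 'k) mpolynomial set"
  proof -
    obtain D where D: "D 0 = C" "\<And>i. i < CARD('v) - card C \<Longrightarrow> D i \<subset> D (Suc i)"
      using exists_subset_chain[of C UNIV] by (metis subset_UNIV)
    \<comment> \<open>The two pieces meet at \<open>i = n\<close>, because
      \<open>Q n = var_ideal C\<close> and \<open>D 0 = C\<close>.\<close>
    define Q' where "Q' i = (if i \<le> n then Q i else var_ideal (D (i - n)))" for i
    have "n + (CARD('v) - card C) \<le> CARD('v)"
    proof (rule prime_chain_length_le[of _ Q'])
      show "primeideal (Q' i) cring_class_ops" for i
        using Q(1) primeideal_var_ideal by (auto simp: Q'_def)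
      fix i assume i: "i < n + (CARD('v) - card C)"
      show "Q' i \<subset> Q' (Suc i)"
      proof (cases "i < n")
        case False
        then have "D (i - n) \<subset> D (Suc i - n)"
          using i D(2)[of "i - n"] by (simp add: Suc_diff_le)
        moreover have "Q' i = var_ideal (D (i - n))"
          using False Q(3) D(1) by (auto simp: Q'_def)
        ultimately show ?thesis
          using False var_ideal_strict_mono by (simp add: Q'_def)
      qed (use Q(2) in \<open>simp add: Q'_def\<close>)
    qed
    moreover have "card C \<le> CARD('v)"
      by (simp add: card_mono)
    ultimately show ?thesis
      by simp
  qed
  then have upper: "x \<le> enat (card C)" if "x \<in> ?S" for x
    using that by force
  have mem: "enat (card C) \<in> ?S"
  proof -
    obtain D where D: "D (card C) = C" "\<And>i. i < card C \<Longrightarrow> D i \<subset> D (Suc i)"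
      using exists_subset_chain[of "{}" C] by (metis empty_subsetI card.empty diff_zero)
    have "\<exists>Q :: nat \<Rightarrow> ('v, 'k) mpolynomial set.
      (\<forall>i\<le>card C. primeideal (Q i) cring_class_ops) \<and> (\<forall>i<card C. Q i \<subset> Q (Suc i)) \<and>
      Q (card C) = var_ideal C"
      using D by (intro exI[of _ "\<lambda>i. var_ideal (D i)"])
        (auto simp: primeideal_var_ideal var_ideal_strict_mono simp del: psubsetI)
    then show ?thesis
      by blast
  qed
  show ?thesis
    unfolding ideal_height_def
  proof (rule Sup_eqI)
    show "enat (card C) \<le> y" if "\<And>z. z \<in> ?S \<Longrightarrow> z \<le> y" for y
      using that mem .
  qed (rule upper)
qed


section \<open>Associated primes of monomial ideals\<close>

text \<open>Among the \<open>f\<close> with \<open>P = (I : f)\<close> take one with the fewest terms. Multiplying it by a monomial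
  outside \<open>P\<close> and dropping the terms in \<open>I\<close> gives another such \<open>f\<close>, so none of its terms can be
  moved into \<open>I\<close> by a monomial outside \<open>P\<close>.\<close>

lemma associated_prime_monomial_colon:
  fixes P :: "('v::finite, 'k::field) mpolynomial set"
  assumes M: "up_closed M" and P: "P \<in> associated_primes cring_class_ops (monomial_ideal M)"
  obtains t where "P = monomial_ideal {u. u + t \<in> M}"
proof -
  let ?I = "monomial_ideal M :: ('v, 'k) mpolynomial set"
  have I: "ideal ?I cring_class_ops"
    by (rule ideal_monomial_ideal[OF M])
  define F where "F = {f. P = {g. g * f \<in> ?I}}"
  have prime: "primeideal P cring_class_ops" and "\<exists>f. f \<in> F"
    using P by (auto simp: associated_primes_def class_simps F_def)
  then obtain f where f: "f \<in> F" and min: "\<And>f'. f' \<in> F \<Longrightarrow> card (keys f) \<le> card (keys f')"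
    using ex_has_least_nat[of "\<lambda>f. f \<in> F" _ "\<lambda>f. card (keys f)"] by blast
  have inP: "g \<in> P \<longleftrightarrow> g * f \<in> ?I" for g
    using f by (auto simp: F_def)
  have ideal: "ideal P cring_class_ops" and "1 \<notin> P"
    and split: "\<And>a b. a * b \<in> P \<Longrightarrow> a \<in> P \<or> b \<in> P"
    using prime ideal_class_eq_UNIV_iff by (auto simp: primeideal_class_iff)
  have keys_u: "keys (single u 1 * f) = (\<lambda>m. m + u) ` keys f" for u
    using keys_mult_single[of 1 f u] by (simp add: mult.commute)
  have shift: "m + u \<notin> M" if m: "m \<in> keys f" and u: "single u 1 \<notin> P" for m u
  proof
    assume mu: "m + u \<in> M"
    \<comment> \<open>\<open>f'\<close> drops from the shifted \<open>f\<close> every term in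
      \<open>M\<close>, in particular the one at \<open>m + u\<close>, so it has fewer terms than
      \<open>f\<close>.\<close>
    define f' where "f' = (\<Sum>n\<in>keys (single u 1 * f) - M. single n (lookup (single u 1 * f) n))"
    define r where "r = (\<Sum>n\<in>keys (single u 1 * f) \<inter> M. single n (lookup (single u 1 * f) n))"
    have "single u 1 * f = (\<Sum>n\<in>keys (single u 1 * f). single n (lookup (single u 1 * f) n))"
      by (simp add: sum_single_lookup)
    also have "\<dots> = r + f'"
      unfolding r_def f'_def by (rule sum.Int_Diff) simp
    finally have decomp: "single u 1 * f = r + f'" .
    have r: "r \<in> ?I"
      unfolding r_def by (rule ideal_class_sum[OF I]) (auto simp: monomial_ideal_def)
    \<comment> \<open>Primality cancels the factor \<open>single u 1 \<notin> P\<close>, and the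
      part \<open>r\<close> lies in the ideal, so it does not affect membership.\<close>
    have "g \<in> P \<longleftrightarrow> g * f' \<in> ?I" for g
    proof -
      have "g \<in> P \<longleftrightarrow> g * single u 1 \<in> P"
        using ideal split[of g "single u 1"] u by (metis ideal_class_iff mult.commute)
      also have "\<dots> \<longleftrightarrow> g * r + g * f' \<in> ?I"
        by (simp add: inP mult.assoc decomp distrib_left)
      also have "\<dots> \<longleftrightarrow> g * f' \<in> ?I"
      proof -
        have "g * r \<in> ?I"
          using r I by (auto simp: ideal_class_iff)
        then show ?thesis
          using I ideal_class_diff[OF I, of "g * r + g * f'" "g * r"] by (auto simp: ideal_class_iff)
      qed
      finally show ?thesis .
    qed
    then have "f' \<in> F"
      by (auto simp: F_def)
    have "keys f' \<subseteq> (\<Union>n\<in>keys (single u 1 * f) - M. {n})"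
      unfolding f'_def by (rule order_trans[OF keys_sum]) (auto split: if_splits)
    also have "\<dots> \<subseteq> (\<lambda>m. m + u) ` (keys f - {m})"
      using mu by (auto simp: keys_u)
    finally have "card (keys f') \<le> card ((\<lambda>m. m + u) ` (keys f - {m}))"
      by (intro card_mono) auto
    also have "\<dots> \<le> card (keys f - {m})"
      by (rule card_image_le) simp
    also have "\<dots> < card (keys f)"
      using m by (intro card_Diff1_less) auto
    finally show False
      using min[OF \<open>f' \<in> F\<close>] by simp
  qed
  \<comment> \<open>By \<open>shift\<close>, a single term \<open>m\<close> of \<open>f\<close>
    already decides whether a monomial belongs to \<open>P\<close>.\<close>
  have monom: "single u 1 \<in> P \<longleftrightarrow> m + u \<in> M" if "m \<in> keys f" for m u
    using shift[OF that] that by (auto simp: inP monomial_ideal_def keys_u)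
  have "f \<notin> ?I"
    using inP[of 1] \<open>1 \<notin> P\<close> by simp
  then have f0: "keys f \<noteq> {}"
    by (auto simp: monomial_ideal_def)
  \<comment> \<open>A term of \<open>g * f\<close> with a unique decomposition puts one monomial of
    \<open>g\<close> into \<open>P\<close>. Subtracting that term leaves an element of
    \<open>P\<close> with fewer terms.\<close>
  have terms: "single u 1 \<in> P" if "g \<in> P" "u \<in> keys g" for g u
    using that
  proof (induction "card (keys g)" arbitrary: g u rule: less_induct)
    case less
    have "keys g \<noteq> {}"
      using less.prems by auto
    then obtain a b where ab: "a \<in> keys g" "b \<in> keys f"
      and uniq: "\<And>a' b'. a' \<in> keys g \<Longrightarrow> b' \<in> keys f \<Longrightarrow> a' + b' = a + b \<Longrightarrow> a' = a \<and> b' = b"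
      using exists_unique_sum[of "keys g" "keys f"] f0 by (metis finite_keys)
    have "lookup (g * f) (a + b) = lookup g a * lookup f b"
      by (rule lookup_mult_unique[OF ab]) (use uniq in blast)
    then have "a + b \<in> keys (g * f)"
      using ab by (simp add: in_keys_iff)
    then have "b + a \<in> M"
      using less.prems(1) by (auto simp: inP monomial_ideal_def add.commute)
    then have a: "single a 1 \<in> P"
      using monom ab(2) by blast
    define g' where "g' = g - single a (lookup g a)"
    have "single a (lookup g a) = single 0 (lookup g a) * single a 1"
      by (simp add: mult_single)
    then have "g' \<in> P"
      unfolding g'_def using ideal a less.prems(1)
      by (intro ideal_class_diff[OF ideal]) (auto simp: ideal_class_iff)
    have k: "keys g' = keys g - {a}"
      by (auto simp: g'_def in_keys_iff lookup_minus lookup_single when_def split: if_splits)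
    show ?case
    proof (cases "u = a")
      case False
      have "card (keys g') < card (keys g)"
        using k ab(1) by (metis card_Diff1_less finite_keys)
      then show ?thesis
        using less.hyps[of g' u] \<open>g' \<in> P\<close> less.prems(2) False k by auto
    qed (use a in simp)
  qed
  obtain t where t: "t \<in> keys f"
    using f0 by blast
  have "P = monomial_ideal {u. u + t \<in> M}"
  proof (intro equalityI subsetI)
    fix g assume "g \<in> P"
    then show "g \<in> monomial_ideal {u. u + t \<in> M}"
      using terms monom[OF t] by (auto simp: monomial_ideal_def add.commute)
  next
    fix g :: "('v, 'k) mpolynomial" assume g: "g \<in> monomial_ideal {u. u + t \<in> M}"
    have "(\<Sum>u\<in>keys g. single 0 (lookup g u) * single u 1) \<in> P"
    proof (rule ideal_class_sum[OF ideal])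
      fix u assume "u \<in> keys g"
      then have "single u 1 \<in> P"
        using g monom[OF t] by (auto simp: monomial_ideal_def add.commute)
      then show "single 0 (lookup g u) * single u 1 \<in> P"
        using ideal by (auto simp: ideal_class_iff)
    qed
    then show "g \<in> P"
      by (simp add: mult_single sum_single_lookup)
  qed
  then show thesis
    by (rule that)
qed

text \<open>By primality a monomial is in \<open>P\<close> iff one of its variables is, as peeling
  off variables one by one shows; \<open>C\<close> collects the variables in
  \<open>P\<close>.\<close>

lemma associated_prime_monomial_ideal:
  fixes P :: "('v::finite, 'k::field) mpolynomial set"
  assumes M: "up_closed M" and P: "P \<in> associated_primes cring_class_ops (monomial_ideal M)"
  obtains C t where "P = var_ideal C" "\<And>u. u + t \<in> M \<longleftrightarrow> u \<in> var_monomials C"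
proof -
  obtain t where t: "P = monomial_ideal {u. u + t \<in> M}"
    by (rule associated_prime_monomial_colon[OF M P])
  have ideal: "ideal P cring_class_ops" and "1 \<notin> P"
    and split: "\<And>a b. a * b \<in> P \<Longrightarrow> a \<in> P \<or> b \<in> P"
    using P ideal_class_eq_UNIV_iff by (auto simp: associated_primes_def primeideal_class_iff)
  define C where "C = {x. single (single x (Suc 0)) 1 \<in> P}"
  have P_iff: "single u 1 \<in> P \<longleftrightarrow> u + t \<in> M" for u
    by (simp add: t monomial_ideal_def)
  have char: "single u 1 \<in> P \<longleftrightarrow> u \<in> var_monomials C" for u
  proof (induction "\<Sum>x\<in>UNIV. lookup u x" arbitrary: u rule: less_induct)
    case less
    show ?case
    proof (cases "u = 0")
      case False
      then obtain x where x: "lookup u x \<noteq> 0"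
        by (metis lookup_zero poly_mapping_eqI)
      define v where "v = u - single x (Suc 0)"
      have u: "u = single x (Suc 0) + v"
        using x by (intro poly_mapping_eqI)
          (auto simp: v_def lookup_add lookup_minus lookup_single when_def)
      have "(\<Sum>y\<in>UNIV. lookup v y) < (\<Sum>y\<in>UNIV. lookup u y)"
        by (rule sum_strict_mono_ex1) (auto simp: u lookup_add intro!: exI[of _ x])
      moreover have "single u 1 = single (single x (Suc 0)) 1 * (single v 1 :: ('v, 'k) mpolynomial)"
        by (simp add: mult_single u)
      then have "single u 1 \<in> P \<longleftrightarrow> single (single x (Suc 0)) 1 \<in> P \<or> single v 1 \<in> P"
        using ideal split by (metis ideal_class_iff mult.commute)
      ultimately show ?thesis
        using less u by (simp add: add_in_var_monomials single_in_var_monomials C_def)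
    qed (use \<open>1 \<notin> P\<close> in \<open>simp add: var_monomials_def\<close>)
  qed
  show thesis
  proof (rule that)
    show "u + t \<in> M \<longleftrightarrow> u \<in> var_monomials C" for u
      using char P_iff by simp
    then show "P = var_ideal C"
      by (simp add: t)
  qed
qed

text \<open>The monomial with exponent \<open>t\<close> is the witness \<open>f\<close> in
  \<open>P = (I : f)\<close>.\<close>

lemma var_ideal_associated:
  assumes "\<And>u. u + t \<in> M \<longleftrightarrow> u \<in> var_monomials C"
  shows "(var_ideal C :: ('v::finite, 'k::field) mpolynomial set)
    \<in> associated_primes cring_class_ops (monomial_ideal M)"
proof -
  have "g * single t 1 \<in> monomial_ideal M \<longleftrightarrow> g \<in> var_ideal C" for g :: "('v, 'k) mpolynomial"
    using assms by (auto simp: monomial_ideal_def keys_mult_single)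
  then show ?thesis
    unfolding associated_primes_def
    by (auto simp: primeideal_var_ideal class_simps intro!: bexI[of _ "single t 1"])
qed


section \<open>Strong vertex covers\<close>

definition vertex_cover :: "('v \<times> 'v) set \<Rightarrow> 'v set \<Rightarrow> bool" where
  "vertex_cover E C \<longleftrightarrow> (\<forall>(x, y)\<in>E. x \<in> C \<or> y \<in> C)"

text \<open>In the literature's partition \<open>C = L\<^sub>1 \<union> L\<^sub>2 \<union> L\<^sub>3\<close> of a cover, \<open>x \<in> L\<^sub>3\<close> means that \<open>C\<close> contains
  all neighbours of \<open>x\<close>, and \<open>y \<in> L\<^sub>2 \<union> L\<^sub>3\<close> that it contains all out-neighbours of \<open>y\<close>.\<close>

definition strong_cover :: "('v \<times> 'v) set \<Rightarrow> ('v \<Rightarrow> nat) \<Rightarrow> 'v set \<Rightarrow> bool" where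
  "strong_cover E w C \<longleftrightarrow> vertex_cover E C \<and>
    (\<forall>x\<in>C. nbrs E x \<subseteq> C \<longrightarrow> (\<exists>y\<in>C. (y, x) \<in> E \<and> y \<in> vplus w \<and> out_nbrs E y \<subseteq> C))"

text \<open>The two inequalities express divisibility by the generator of the edge
  \<open>(x, y)\<close>, because \<open>x \<noteq> y\<close>.\<close>

definition edge_monomials :: "('v \<times> 'v) set \<Rightarrow> ('v \<Rightarrow> nat) \<Rightarrow> ('v \<Rightarrow>\<^sub>0 nat) set" where
  "edge_monomials E w = {m. \<exists>x y. (x, y) \<in> E \<and> 1 \<le> lookup m x \<and> w y \<le> lookup m y}"

lemma up_closed_edge_monomials: "up_closed (edge_monomials E w)"
  unfolding up_closed_def edge_monomials_def by (fastforce simp: lookup_add intro: trans_le_add2)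

lemma X_power: "X x ^ n = (single (single x n) 1 :: ('v, 'k::field) mpolynomial)"
proof (induction n)
  case (Suc n)
  then show ?case
    by (simp add: X_def mult_single flip: single_add)
qed simp

context weighted_oriented_graph
begin

lemma edge_iff: "{x, y} \<in> G \<longleftrightarrow> (x, y) \<in> E \<or> (y, x) \<in> E"
proof
  assume "{x, y} \<in> G"
  then have "{x, y} \<in> (\<lambda>(x, y). {x, y}) ` E"
    using orientation by (simp add: bij_betw_def)
  then show "(x, y) \<in> E \<or> (y, x) \<in> E"
    by (auto simp: doubleton_eq_iff)
next
  assume "(x, y) \<in> E \<or> (y, x) \<in> E"
  then show "{x, y} \<in> G"
    using bij_betwE[OF orientation] by (auto simp: insert_commute)
qed

lemma edge_neq: "(x, y) \<in> E \<Longrightarrow> x \<noteq> y"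
  using simple_graph[of "{x, y}"] by (auto simp: edge_iff)

lemma edge_antisym: "(x, y) \<in> E \<Longrightarrow> (y, x) \<notin> E"
  using orientation edge_neq[of x y] inj_onD[of "\<lambda>(x, y). {x, y}" E "(x, y)" "(y, x)"]
  by (auto simp: bij_betw_def insert_commute)

lemma edge_ideal_eq:
  "(edge_ideal E w :: ('v, 'k::field) mpolynomial set) = monomial_ideal (edge_monomials E w)"
proof (intro equalityI subsetI)
  let ?A = "{X x * X y ^ w y | x y. (x, y) \<in> E} :: ('v, 'k) mpolynomial set"
  have gen: "X x * X y ^ w y = (single (single x 1 + single y (w y)) 1 :: ('v, 'k) mpolynomial)" for x y
    unfolding X_power by (simp add: X_def mult_single)
  have "?A \<subseteq> monomial_ideal (edge_monomials E w)"
    by (fastforce simp: gen single_in_monomial_ideal edge_monomials_def lookup_add)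
  then show "p \<in> monomial_ideal (edge_monomials E w)" if "p \<in> edge_ideal E w" for p :: "('v, 'k) mpolynomial"
    using that ideal_monomial_ideal[OF up_closed_edge_monomials]
    unfolding edge_ideal_def genideal_def by blast
  show "p \<in> edge_ideal E w" if p: "p \<in> monomial_ideal (edge_monomials E w)" for p :: "('v, 'k) mpolynomial"
    unfolding edge_ideal_def genideal_def
  proof (clarify)
    fix I :: "('v, 'k) mpolynomial set"
    assume I: "ideal I cring_class_ops" "?A \<subseteq> I"
    have "(\<Sum>m\<in>keys p. single m (lookup p m)) \<in> I"
    proof (rule ideal_class_sum[OF I(1)])
      fix m assume "m \<in> keys p"
      then obtain x y where xy: "(x, y) \<in> E" "1 \<le> lookup m x" "w y \<le> lookup m y"
        using p by (auto simp: monomial_ideal_def edge_monomials_def)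
      define g where "g = single x 1 + single y (w y)"
      \<comment> \<open>Subtraction of exponents is truncated, so \<open>g\<close> must be bounded
        by \<open>m\<close> at every variable; at \<open>x\<close> and \<open>y\<close> this uses
        \<open>x \<noteq> y\<close>.\<close>
      have m: "m = (m - g) + g"
      proof (rule poly_mapping_eqI)
        fix z
        have "lookup g z \<le> lookup m z"
          using xy edge_neq[OF xy(1)] by (auto simp: g_def lookup_add lookup_single when_def)
        then show "lookup m z = lookup (m - g + g) z"
          by (simp add: lookup_add lookup_minus)
      qed
      have "single g 1 \<in> I"
        using I(2) xy(1) gen[of x y] unfolding g_def by force
      then have "single (m - g) (lookup p m) * single g 1 \<in> I"
        using I(1) by (auto simp: ideal_class_iff)
      then show "single m (lookup p m) \<in> I"
        using m by (simp add: mult_single)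
    qed
    then show "p \<in> I"
      by (simp add: sum_single_lookup)
  qed
qed

section \<open>Strong covers as colons by a monomial\<close>

lemma strong_cover_if_colon:
  assumes colon: "\<And>u. u + t \<in> edge_monomials E w \<longleftrightarrow> u \<in> var_monomials C"
  shows "strong_cover E w C"
proof -
  let ?M = "edge_monomials E w"
  have t: "t \<notin> ?M"
    using colon[of 0] by (simp add: var_monomials_def)
  have var: "x \<in> C \<longleftrightarrow> single x 1 + t \<in> ?M" for x
    by (simp add: colon single_in_var_monomials)
  \<comment> \<open>As \<open>t\<close> is not in \<open>?M\<close> but one more factor
    \<open>x\<close> puts it there, \<open>t\<close> lacks exactly that factor for some edge
    monomial, with \<open>x\<close> either the tail or the head. In particular
    \<open>lookup t x < w x\<close> on \<open>C\<close>.\<close>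
  have cases: "(\<exists>y. (x, y) \<in> E \<and> lookup t x = 0 \<and> w y \<le> lookup t y) \<or>
      (\<exists>y. (y, x) \<in> E \<and> 1 \<le> lookup t y \<and> Suc (lookup t x) = w x)" if x: "x \<in> C" for x
  proof -
    obtain a b where ab: "(a, b) \<in> E" "1 \<le> lookup (single x 1 + t) a" "w b \<le> lookup (single x 1 + t) b"
      using x[unfolded var edge_monomials_def] by blast
    have no: "\<not> (1 \<le> lookup t a \<and> w b \<le> lookup t b)"
      using t ab(1) by (auto simp: edge_monomials_def)
    show ?thesis
      using ab no edge_neq[OF ab(1)]
      by (cases "a = x"; cases "b = x") (auto simp: lookup_add lookup_single when_def)
  qed
  have cover: "x \<in> C \<or> y \<in> C" if "(x, y) \<in> E" for x y
  proof -
    have "single x 1 + single y (w y) + t \<in> ?M"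
      using that by (fastforce simp: edge_monomials_def lookup_add)
    then have "single x 1 + single y (w y) \<in> var_monomials C"
      by (simp only: colon)
    then show ?thesis
      by (auto simp: var_monomials_def keys_exponent_add split: if_splits)
  qed
  have "\<exists>y\<in>C. (y, x) \<in> E \<and> y \<in> vplus w \<and> out_nbrs E y \<subseteq> C" if x: "x \<in> C" "nbrs E x \<subseteq> C" for x
  proof -
    \<comment> \<open>In the tail case the head \<open>y\<close> would lie in \<open>C\<close> and
      have full exponent, against \<open>cases\<close> for \<open>y\<close>.\<close>
    have "\<not> (\<exists>y. (x, y) \<in> E \<and> lookup t x = 0 \<and> w y \<le> lookup t y)"
    proof clarify
      fix y assume y: "(x, y) \<in> E" "w y \<le> lookup t y"
      then have "y \<in> C"
        using x(2) by (auto simp: nbrs_def out_nbrs_def)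
      then show False
        using cases[of y] y(2) weight_pos[of y] by auto
    qed
    then obtain y where y: "(y, x) \<in> E" "1 \<le> lookup t y"
      using cases[OF x(1)] by blast
    have "y \<in> C"
      using y(1) x(2) by (auto simp: nbrs_def in_nbrs_def)
    then have "y \<in> vplus w"
      using cases[of y] y(2) by (auto simp: vplus_def)
    have "z \<in> C" if "(y, z) \<in> E" for z
    proof -
      have "single z (w z) + t \<in> ?M"
        unfolding edge_monomials_def using that y(2) by (fastforce simp: lookup_add)
      then have "single z (w z) \<in> var_monomials C"
        by (simp only: colon)
      then show ?thesis
        by (auto simp: var_monomials_def split: if_splits)
    qed
    then show ?thesis
      using \<open>y \<in> C\<close> \<open>y \<in> vplus w\<close> y(1) by (auto simp: out_nbrs_def)
  qed
  then show ?thesis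
    using cover by (auto simp: strong_cover_def vertex_cover_def)
qed

lemma colon_if_strong_cover:
  assumes "strong_cover E w C"
  obtains t where "\<And>u. u + t \<in> edge_monomials E w \<longleftrightarrow> u \<in> var_monomials C"
proof -
  \<comment> \<open>The exponent is full outside \<open>C\<close>, one short of the weight where all
    out-neighbours lie in \<open>C\<close>, and \<open>0\<close> where some out-neighbour is
    outside.\<close>
  define t :: "'v \<Rightarrow>\<^sub>0 nat" where
    "t = Abs_poly_mapping (\<lambda>x. if x \<notin> C then w x else if out_nbrs E x \<subseteq> C then w x - 1 else 0)"
  have t: "lookup t x = (if x \<notin> C then w x else if out_nbrs E x \<subseteq> C then w x - 1 else 0)" for x
    unfolding t_def by (subst lookup_Abs_poly_mapping) auto
  show thesis
  proof (rule that, rule iffI)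
    fix u assume "u + t \<in> edge_monomials E w"
    then obtain x y where xy: "(x, y) \<in> E" "1 \<le> lookup (u + t) x" "w y \<le> lookup (u + t) y"
      by (auto simp: edge_monomials_def)
    show "u \<in> var_monomials C"
    proof (rule ccontr)
      assume "u \<notin> var_monomials C"
      then have u: "lookup u z = 0" if "z \<in> C" for z
        using that by (auto simp: var_monomials_def in_keys_iff)
      \<comment> \<open>On \<open>C\<close> the exponent \<open>t\<close> stays below the weight and
        \<open>u\<close> vanishes. The head is thus outside \<open>C\<close>, so the tail is in
        \<open>C\<close> with an out-neighbour outside, where \<open>t\<close> is
        \<open>0\<close>.\<close>
      have "y \<notin> C"
        using xy(3) weight_pos[of y] u[of y] by (auto simp: lookup_add t split: if_splits)
      moreover from this have "x \<in> C"
        using assms xy(1) by (auto simp: strong_cover_def vertex_cover_def)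
      ultimately show False
        using xy(1,2) u[of x] by (auto simp: lookup_add t out_nbrs_def split: if_splits)
    qed
  next
    fix u assume "u \<in> var_monomials C"
    then obtain x where x: "x \<in> C" "1 \<le> lookup u x"
      by (auto simp: var_monomials_def in_keys_iff Suc_le_eq)
    have "\<exists>a b. (a, b) \<in> E \<and> 1 \<le> lookup u a + lookup t a \<and> w b \<le> lookup u b + lookup t b"
    proof (cases "out_nbrs E x \<subseteq> C")
      case False
      then obtain y where "(x, y) \<in> E" "y \<notin> C"
        by (auto simp: out_nbrs_def)
      then show ?thesis
        using x by (intro exI[of _ x] exI[of _ y]) (auto simp: t)
    next
      case True
      \<comment> \<open>With \<open>u\<close>, the exponent at \<open>x\<close> reaches
        \<open>w x\<close>; only a tail is missing. It is any in-neighbour outside \<open>C\<close>,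
        or else the heavy vertex given by strongness, with exponent
        \<open>w y - 1 \<ge> 1\<close>.\<close>
      have "\<exists>y. (y, x) \<in> E \<and> 1 \<le> lookup t y"
      proof (cases "in_nbrs E x \<subseteq> C")
        case True
        then have "nbrs E x \<subseteq> C"
          using \<open>out_nbrs E x \<subseteq> C\<close> by (auto simp: nbrs_def)
        then show ?thesis
          using assms x(1) by (fastforce simp: strong_cover_def t vplus_def)
      next
        case False
        then show ?thesis
          using weight_pos by (auto simp: in_nbrs_def t)
      qed
      then obtain y where "(y, x) \<in> E" "1 \<le> lookup t y"
        by blast
      then show ?thesis
        using x True by (intro exI[of _ y] exI[of _ x]) (auto simp: t)
    qed
    then show "u + t \<in> edge_monomials E w"
      by (simp add: edge_monomials_def lookup_add)
  qed
qed

lemma unmixed_edge_ideal_iff: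
  "unmixed cring_class_ops (edge_ideal E w :: ('v, 'k::field) mpolynomial set) \<longleftrightarrow>
    (\<forall>C D. strong_cover E w C \<and> strong_cover E w D \<longrightarrow> card C = card D)"
proof -
  have "associated_primes cring_class_ops (edge_ideal E w :: ('v, 'k) mpolynomial set) =
      var_ideal ` {C. strong_cover E w C}"
  proof (intro equalityI subsetI)
    fix P assume "P \<in> associated_primes cring_class_ops (edge_ideal E w :: ('v, 'k) mpolynomial set)"
    then obtain C t where "P = var_ideal C" "\<And>u. u + t \<in> edge_monomials E w \<longleftrightarrow> u \<in> var_monomials C"
      unfolding edge_ideal_eq by (rule associated_prime_monomial_ideal[OF up_closed_edge_monomials]) blast
    then show "P \<in> var_ideal ` {C. strong_cover E w C}"
      using strong_cover_if_colon by blast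
  next
    fix P :: "('v, 'k) mpolynomial set" assume "P \<in> var_ideal ` {C. strong_cover E w C}"
    then obtain C where C: "P = var_ideal C" "strong_cover E w C"
      by blast
    obtain t where "\<And>u. u + t \<in> edge_monomials E w \<longleftrightarrow> u \<in> var_monomials C"
      using colon_if_strong_cover[OF C(2)] by blast
    then show "P \<in> associated_primes cring_class_ops (edge_ideal E w)"
      unfolding edge_ideal_eq C(1) by (rule var_ideal_associated)
  qed
  then show ?thesis
    by (auto simp: unmixed_def ideal_height_var_ideal)
qed


section \<open>Stable sets and the neighbourhood condition\<close>

lemma stable_set_iff: "stable_set G S \<longleftrightarrow> vertex_cover E (- S)"
  by (auto simp: stable_set_def vertex_cover_def edge_iff)

text \<open>Maximal stable sets are the complements of minimal covers: no vertex of
  \<open>- S\<close> can be removed from the cover. The extra condition in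
  \<open>strong_cover\<close> is then vacuous.\<close>

lemma maximal_stable_set_iff:
  "maximal_stable_set G S \<longleftrightarrow> vertex_cover E (- S) \<and> (\<forall>x\<in>- S. \<not> nbrs E x \<subseteq> - S)"
proof
  assume S: "maximal_stable_set G S"
  then have st: "stable_set G S"
    by (simp add: maximal_stable_set_def)
  have "\<not> nbrs E x \<subseteq> - S" if "x \<notin> S" for x
  proof
    assume "nbrs E x \<subseteq> - S"
    then have "stable_set G (insert x S)"
      using st edge_neq by (auto simp: stable_set_def edge_iff nbrs_def in_nbrs_def out_nbrs_def)
    then show False
      using S that by (auto simp: maximal_stable_set_def)
  qed
  then show "vertex_cover E (- S) \<and> (\<forall>x\<in>- S. \<not> nbrs E x \<subseteq> - S)"
    using st by (simp add: stable_set_iff)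
next
  assume S: "vertex_cover E (- S) \<and> (\<forall>x\<in>- S. \<not> nbrs E x \<subseteq> - S)"
  have "T = S" if T: "stable_set G T" "S \<subseteq> T" for T
  proof (rule ccontr)
    assume "T \<noteq> S"
    then obtain x where x: "x \<in> T" "x \<notin> S"
      using T by blast
    then obtain y where "y \<in> nbrs E x" "y \<in> S"
      using S by auto
    then have "{x, y} \<in> G"
      by (auto simp: edge_iff nbrs_def in_nbrs_def out_nbrs_def)
    then show False
      using T x \<open>y \<in> S\<close> by (auto simp: stable_set_def)
  qed
  then show "maximal_stable_set G S"
    using S by (auto simp: maximal_stable_set_def stable_set_iff)
qed

lemma strong_cover_if_maximal_stable: "maximal_stable_set G S \<Longrightarrow> strong_cover E w (- S)"
  by (auto simp: maximal_stable_set_iff strong_cover_def)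

text \<open>Maximality is relative to \<open>A\<close>, so that the extension can be kept away from
  an out-neighbourhood.\<close>

lemma stable_set_extend:
  assumes "stable_set G S" "S \<subseteq> A"
  obtains T where "stable_set G T" "S \<subseteq> T" "T \<subseteq> A"
    "\<And>T'. stable_set G T' \<Longrightarrow> T \<subseteq> T' \<Longrightarrow> T' \<subseteq> A \<Longrightarrow> T' = T"
proof -
  obtain T where "stable_set G T" "T \<subseteq> A" "S \<subseteq> T"
    "\<forall>T'\<in>{T. stable_set G T \<and> T \<subseteq> A}. T \<subseteq> T' \<longrightarrow> T = T'"
    using finite_has_maximal2[of "{T. stable_set G T \<and> T \<subseteq> A}" S] assms by auto
  then show thesis
    by (intro that[of T]) auto
qed

text \<open>A maximal stable set containing \<open>T\<close> has a strong cover as complement; equal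
  cardinalities force it to be \<open>S\<close>.\<close>

lemma stable_superset_eq_if_strong_cover:
  assumes "\<And>C D. strong_cover E w C \<Longrightarrow> strong_cover E w D \<Longrightarrow> card C = card D"
    and "strong_cover E w (- S)" "stable_set G T" "S \<subseteq> T"
  shows "T = S"
proof -
  obtain T' where T': "T \<subseteq> T'" "maximal_stable_set G T'"
    using stable_set_extend[OF assms(3) subset_UNIV] by (metis maximal_stable_set_def subset_UNIV)
  then have "card (- S) = card (- T')"
    using assms(1,2) strong_cover_if_maximal_stable by blast
  then have "- T' = - S"
    using T'(1) assms(4) by (intro card_subset_eq) auto
  then show ?thesis
    using T'(1) assms(4) by auto
qed

lemma strong_cover_complement_maximal:
  assumes nb: "\<forall>x y. (y, x) \<in> E \<and> y \<in> vplus w \<longrightarrow>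
      (\<exists>y' \<in> nbrs E x - {y}. nbrs E y' \<subseteq> out_nbrs E y)"
    and C: "strong_cover E w C"
  shows "maximal_stable_set G (- C)"
proof -
  have strong: "\<exists>y\<in>C. (y, x) \<in> E \<and> y \<in> vplus w \<and> out_nbrs E y \<subseteq> C" if "x \<in> C" "nbrs E x \<subseteq> C" for x
    using C that by (auto simp: strong_cover_def)
  have False if x: "x \<in> C" "nbrs E x \<subseteq> C" for x
  proof -
    obtain y where y: "(y, x) \<in> E" "y \<in> vplus w" "out_nbrs E y \<subseteq> C"
      using strong[OF x] by blast
    then obtain y' where y': "y' \<in> nbrs E x" "nbrs E y' \<subseteq> out_nbrs E y"
      using nb by blast
    \<comment> \<open>\<open>y'\<close> lies in \<open>C\<close> as a neighbour of \<open>x\<close>,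
      and its neighbours lie in \<open>out_nbrs E y \<subseteq> C\<close>, so strongness applies to
      \<open>y'\<close>.\<close>
    then obtain z where z: "(z, y') \<in> E" "z \<in> vplus w"
      using strong[of y'] x(2) y(3) by blast
    then obtain z' where z': "z' \<in> nbrs E y'" "nbrs E z' \<subseteq> out_nbrs E z"
      using nb by blast
    \<comment> \<open>Both \<open>z\<close> and \<open>z'\<close> are neighbours of
      \<open>y'\<close>, hence out-neighbours of \<open>y\<close>. So \<open>y\<close> is a
      neighbour of \<open>z'\<close>, and hence an out-neighbour of \<open>z\<close>.\<close>
    have "(y, z') \<in> E" "(y, z) \<in> E"
      using z' z y'(2) by (auto simp: nbrs_def in_nbrs_def out_nbrs_def)
    moreover from this have "(z, y) \<in> E"
      using z'(2) by (auto simp: nbrs_def in_nbrs_def out_nbrs_def)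
    ultimately show False
      using edge_antisym by blast
  qed
  then show ?thesis
    using C by (auto simp: maximal_stable_set_iff strong_cover_def)
qed

section \<open>Short cycles and necessity of the neighbourhood condition\<close>

lemma triangle_cycle:
  assumes "{a, b} \<in> G" "{b, c} \<in> G" "{c, a} \<in> G"
  shows "has_cycle G 3"
proof -
  have "a \<noteq> b" "b \<noteq> c" "c \<noteq> a"
    using assms edge_neq unfolding edge_iff by blast+
  moreover have "{[a, b, c] ! i, [a, b, c] ! (Suc i mod 3)} \<in> G" if "i < 3" for i
  proof -
    have "i = 0 \<or> i = 1 \<or> i = 2"
      using that by arith
    then show ?thesis
      using assms by (elim disjE) simp_all
  qed
  ultimately show ?thesis
    unfolding has_cycle_def by (intro exI[of _ "[a, b, c]"]) auto
qed

lemma pentagon_cycle: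
  assumes "{a, b} \<in> G" "{b, c} \<in> G" "{c, d} \<in> G" "{d, e} \<in> G" "{e, a} \<in> G"
    and "a \<noteq> c" "a \<noteq> d" "b \<noteq> d" "b \<noteq> e" "c \<noteq> e"
  shows "has_cycle G 5"
proof -
  have "a \<noteq> b" "b \<noteq> c" "c \<noteq> d" "d \<noteq> e" "e \<noteq> a"
    using assms edge_neq unfolding edge_iff by blast+
  then have "distinct [a, b, c, d, e]"
    using assms by auto
  moreover have "{[a, b, c, d, e] ! i, [a, b, c, d, e] ! (Suc i mod 5)} \<in> G" if "i < 5" for i
  proof -
    have "i = 0 \<or> i = 1 \<or> i = 2 \<or> i = 3 \<or> i = 4"
      using that by arith
    then show ?thesis
      using assms(1-5) by (elim disjE) simp_all
  qed
  ultimately show ?thesis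
    unfolding has_cycle_def by (intro exI[of _ "[a, b, c, d, e]"]) auto
qed

text \<open>If the condition fails for \<open>(y, x)\<close>, choose for each neighbour \<open>y' \<noteq> y\<close> of \<open>x\<close> a neighbour
  outside \<open>N\<^sup>+(y)\<close>, and an in-neighbour of \<open>y\<close>. Without 3- and 5-cycles these vertices form a
  stable set \<open>Z\<close>. The complement of a maximal stable set \<open>S \<supseteq> Z\<close> avoiding \<open>N\<^sup>+(y)\<close> is a strong
  cover, yet \<open>S \<union> {x}\<close> is stable.\<close>

lemma neighbourhood_condition_if_unmixed:
  assumes no3: "\<not> has_cycle G 3" and no5: "\<not> has_cycle G 5"
    and unm: "\<And>C D. strong_cover E w C \<Longrightarrow> strong_cover E w D \<Longrightarrow> card C = card D"
    and yx: "(y, x) \<in> E" "y \<in> vplus w"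
  shows "\<exists>y' \<in> nbrs E x - {y}. nbrs E y' \<subseteq> out_nbrs E y"
proof (rule ccontr)
  assume neg: "\<not> ?thesis"
  have nbrs_iff: "b \<in> nbrs E a \<longleftrightarrow> {a, b} \<in> G" for a b
    by (auto simp: edge_iff nbrs_def in_nbrs_def out_nbrs_def)
  have loop: "{a, a} \<notin> G" for a
    using edge_neq[of a a] edge_iff[of a a] by blast
  have "\<forall>y'\<in>nbrs E x - {y}. \<exists>z. z \<in> nbrs E y' \<and> z \<notin> out_nbrs E y"
    using neg by blast
  then obtain \<zeta> where \<zeta>: "\<And>y'. {x, y'} \<in> G \<Longrightarrow> y' \<noteq> y \<Longrightarrow> {y', \<zeta> y'} \<in> G"
    "\<And>y'. {x, y'} \<in> G \<Longrightarrow> y' \<noteq> y \<Longrightarrow> \<zeta> y' \<notin> out_nbrs E y"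
    unfolding nbrs_iff by (metis DiffI nbrs_iff singletonD)
  \<comment> \<open>Sources have weight \<open>1\<close>, so the heavy vertex \<open>y\<close> is
    not a source.\<close>
  have "in_nbrs E y \<noteq> {}"
    using yx(2) source_weight[of y] by (auto simp: vplus_def)
  then obtain z where z: "(z, y) \<in> E"
    by (auto simp: in_nbrs_def)
  define f where "f y' = (if y' = y then z else \<zeta> y')" for y'
  have x_out: "x \<in> out_nbrs E y"
    using yx(1) by (simp add: out_nbrs_def)
  have f: "{y', f y'} \<in> G" "f y' \<notin> out_nbrs E y" "f y' \<noteq> x" if "{x, y'} \<in> G" for y'
    using \<zeta>[OF that] z edge_antisym x_out by (auto simp: f_def edge_iff out_nbrs_def)
  have f_nadj: "{x, f y'} \<notin> G" if "{x, y'} \<in> G" for y'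
    using triangle_cycle[of x y' "f y'"] f(1)[OF that] that no3 by (auto simp: insert_commute)
  \<comment> \<open>An edge between \<open>f a\<close> and \<open>f b\<close> would close the
    pentagon \<open>x, a, f a, f b, b\<close>; its vertices are distinct because \<open>x\<close> is
    adjacent to \<open>a\<close> and \<open>b\<close> but, without triangles, not to
    \<open>f a\<close> or \<open>f b\<close>.\<close>
  have stable: "stable_set G (f ` nbrs E x)"
    unfolding stable_set_def
  proof (clarsimp simp: nbrs_iff)
    fix a b assume ab: "{x, a} \<in> G" "{x, b} \<in> G" "{f a, f b} \<in> G"
    have "a \<noteq> b" "a \<noteq> f b" "b \<noteq> f a"
      using ab loop f_nadj by auto
    then have "has_cycle G 5"
      using ab f[OF ab(1)] f[OF ab(2)]
      by (intro pentagon_cycle[of x a "f a" "f b" b]) (auto simp: insert_commute)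
    then show False
      using no5 by simp
  qed
  moreover have "f ` nbrs E x \<subseteq> - out_nbrs E y"
    using f(2) by (auto simp: nbrs_iff)
  ultimately obtain S where S: "stable_set G S" "f ` nbrs E x \<subseteq> S" "S \<subseteq> - out_nbrs E y"
    and max: "\<And>T. stable_set G T \<Longrightarrow> S \<subseteq> T \<Longrightarrow> T \<subseteq> - out_nbrs E y \<Longrightarrow> T = S"
    by (rule stable_set_extend) blast
  have stable_insert: "stable_set G (insert u S)" if "nbrs E u \<subseteq> - S" for u
    using S(1) that loop by (auto simp: stable_set_def nbrs_iff insert_commute subset_iff)
  have nbrs_x: "nbrs E x \<subseteq> - S"
  proof
    fix a assume "a \<in> nbrs E x"
    then have "{a, f a} \<in> G" "f a \<in> S"
      using f(1) S(2) by (auto simp: nbrs_iff)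
    then show "a \<in> - S"
      using S(1) by (auto simp: stable_set_def)
  qed
  have y: "y \<in> - S"
    using nbrs_x yx(1) by (auto simp: nbrs_def in_nbrs_def)
  \<comment> \<open>By relative maximality only vertices of \<open>out_nbrs E y\<close> can have all
    neighbours in \<open>- S\<close>. For these \<open>y\<close> is the required heavy in-neighbour,
    as \<open>S\<close> avoids \<open>out_nbrs E y\<close>.\<close>
  have "strong_cover E w (- S)"
    unfolding strong_cover_def
  proof (intro conjI ballI impI)
    show "vertex_cover E (- S)"
      using S(1) by (simp add: stable_set_iff)
    fix u assume u: "u \<in> - S" "nbrs E u \<subseteq> - S"
    have "u \<in> out_nbrs E y"
    proof (rule ccontr)
      assume "u \<notin> out_nbrs E y"
      then have "insert u S = S"
        using max[OF stable_insert[OF u(2)]] S(3) by auto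
      then show False
        using u(1) by auto
    qed
    then show "\<exists>v\<in>- S. (v, u) \<in> E \<and> v \<in> vplus w \<and> out_nbrs E v \<subseteq> - S"
      using y yx(2) S(3) by (auto simp: out_nbrs_def)
  qed
  \<comment> \<open>Each neighbour \<open>a\<close> of \<open>x\<close> is adjacent to
    \<open>f a \<in> S\<close>, hence not in \<open>S\<close>, so \<open>x\<close> can be added; but
    \<open>x \<in> out_nbrs E y\<close> is not in \<open>S\<close>.\<close>
  then have "insert x S = S"
    using stable_superset_eq_if_strong_cover[OF unm _ stable_insert[OF nbrs_x]] by blast
  then show False
    using S(3) x_out by auto
qed

end

theorem theorem5p4:
  fixes G :: "'v::finite set set" and E :: "('v \<times> 'v) set" and w :: "'v \<Rightarrow> nat"
  assumes "weighted_oriented_graph G E w"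
    and "\<not> has_cycle G 3"
    and "\<not> has_cycle G 5"
  shows "unmixed cring_class_ops (edge_ideal E w :: ('v, 'k::field) mpolynomial set) \<longleftrightarrow>
    well_covered G \<and>
    (\<forall>x y. (y, x) \<in> E \<and> y \<in> vplus w \<longrightarrow>
      (\<exists>y' \<in> nbrs E x - {y}. nbrs E y' \<subseteq> out_nbrs E y))"
    (is "?unmixed \<longleftrightarrow> well_covered G \<and> ?nb")
proof -
  interpret weighted_oriented_graph G E w
    by fact
  have compl: "card (- A) = card (- B) \<longleftrightarrow> card A = card B" for A B :: "'v set"
    using card_mono[of UNIV A] card_mono[of UNIV B] by (auto simp: Compl_eq_Diff_UNIV card_Diff_subset)
  show ?thesis
  proof
    assume ?unmixed
    then have unm: "\<And>C D. strong_cover E w C \<Longrightarrow> strong_cover E w D \<Longrightarrow> card C = card D"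
      using unmixed_edge_ideal_iff by blast
    have "well_covered G"
      unfolding well_covered_def using unm strong_cover_if_maximal_stable compl by blast
    then show "well_covered G \<and> ?nb"
      using neighbourhood_condition_if_unmixed[OF assms(2,3) unm] by blast
  next
    assume *: "well_covered G \<and> ?nb"
    then have "card C = card D" if "strong_cover E w C" "strong_cover E w D" for C D
      using that strong_cover_complement_maximal compl[of C D] by (auto simp: well_covered_def)
    then show ?unmixed
      using unmixed_edge_ideal_iff by blast
  qed
qed

end
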